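(* Let $T=(V,E)$ be a (finite or infinite) combinatorial tree with at least two vertices, let $A$ be a finite subset of $V$, and let $\ell:V\to 2^A$ be a proper labelling. Then $T$ contains a fully-labelled edge, i.e. there is an edge $e=\{x,y\}\in E$ with $\ell(x)\cup\ell(y)=A$.
   Context: A tree $T=(V,E)$ is a connected acyclic graph with vertex set $V$ and edge set $E$; $V$ may be finite or infinite, and $V$ is assumed to have at least two vertices. Between any two vertices there is a unique (finite) path of edges. $2^A$ denotes the power set of $A$. For a subset $A\subseteq V$ (the labels), a labelling $\ell:V\to 2^A$ is called proper if: (i) for each $a\in A$, $a\in\ell(a)$; and (ii) whenever $v\in V$ lies on the unique path between $a,b\in A$, $\ell(v)$ contains $a$ or $b$. An edge with endpoints $x,y$ is fully-labelled if $\ell(x)\cup\ell(y)=A$. *)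

theory Defs
  imports Main
begin

text \<open>Simple undirected graphs, finite or infinite: an edge is the two-element set of its endpoints.\<close>

definition simple_graph :: "'v set \<Rightarrow> 'v set set \<Rightarrow> bool" where
  "simple_graph V E \<longleftrightarrow> (\<forall>e\<in>E. e \<subseteq> V \<and> card e = 2)"

text \<open>A path is the nonempty list of its pairwise distinct vertices; singletons are paths of length 0.\<close>

definition is_path :: "'v set \<Rightarrow> 'v set set \<Rightarrow> 'v list \<Rightarrow> bool" where
  "is_path V E p \<longleftrightarrow>
     p \<noteq> [] \<and> set p \<subseteq> V \<and> distinct p \<and> successively (\<lambda>x y. {x, y} \<in> E) p"

definition path_between :: "'v set \<Rightarrow> 'v set set \<Rightarrow> 'v \<Rightarrow> 'v \<Rightarrow> 'v list \<Rightarrow> bool" where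
  "path_between V E a b p \<longleftrightarrow> is_path V E p \<and> hd p = a \<and> last p = b"

definition connected_graph :: "'v set \<Rightarrow> 'v set set \<Rightarrow> bool" where
  "connected_graph V E \<longleftrightarrow> V \<noteq> {} \<and> (\<forall>a\<in>V. \<forall>b\<in>V. \<exists>p. path_between V E a b p)"

text \<open>
  The lower bound on the length keeps a single edge, traversed back and forth, from counting as a
  cycle.
\<close>

definition is_cycle :: "'v set \<Rightarrow> 'v set set \<Rightarrow> 'v list \<Rightarrow> bool" where
  "is_cycle V E c \<longleftrightarrow> is_path V E c \<and> length c \<ge> 3 \<and> {last c, hd c} \<in> E"

definition acyclic_graph :: "'v set \<Rightarrow> 'v set set \<Rightarrow> bool" where
  "acyclic_graph V E \<longleftrightarrow> (\<nexists>c. is_cycle V E c)"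

definition is_tree :: "'v set \<Rightarrow> 'v set set \<Rightarrow> bool" where
  "is_tree V E \<longleftrightarrow> simple_graph V E \<and> connected_graph V E \<and> acyclic_graph V E"

text \<open>
  Labellings are total functions of which only the values on \<open>V\<close> matter. In a tree there is exactly
  one \<open>p\<close> with \<open>path_between V E a b p\<close>, so the quantifier over \<open>p\<close> below ranges over the unique
  path between \<open>a\<close> and \<open>b\<close>.
\<close>

definition labelling :: "'v set \<Rightarrow> 'v set \<Rightarrow> ('v \<Rightarrow> 'v set) \<Rightarrow> bool" where
  "labelling V A l \<longleftrightarrow> (\<forall>v\<in>V. l v \<subseteq> A)"

definition proper_labelling ::
    "'v set \<Rightarrow> 'v set set \<Rightarrow> 'v set \<Rightarrow> ('v \<Rightarrow> 'v set) \<Rightarrow> bool" where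
  "proper_labelling V E A l \<longleftrightarrow>
     labelling V A l \<and>
     (\<forall>a\<in>A. a \<in> l a) \<and>
     (\<forall>a\<in>A. \<forall>b\<in>A. \<forall>p. path_between V E a b p \<longrightarrow> (\<forall>v\<in>set p. a \<in> l v \<or> b \<in> l v))"

definition fully_labelled :: "'v set \<Rightarrow> ('v \<Rightarrow> 'v set) \<Rightarrow> 'v set \<Rightarrow> bool" where
  "fully_labelled A l e \<longleftrightarrow> (\<exists>x y. e = {x, y} \<and> l x \<union> l y = A)"

end

theory Submission
  imports Defs
begin

text \<open>
  Call a label \<open>a \<in> A\<close> missing at a vertex \<open>v\<close> if \<open>a \<notin> l v\<close>. Properness says that \<open>v\<close> never lies on
  the path between two labels missing at \<open>v\<close>; hence all labels missing at \<open>v\<close> lie in a single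
  component of \<open>T - v\<close>, which contains exactly one neighbour \<open>w\<close> of \<open>v\<close>. If nothing is missing at
  \<open>v\<close>, every edge at \<open>v\<close> is fully labelled; otherwise move from \<open>v\<close> to \<open>w\<close>.

  If the labels missing at \<open>w\<close> send the walk straight back to \<open>v\<close>, they lie on the side of \<open>v\<close> of
  the edge \<open>{v, w}\<close>, whereas those missing at \<open>v\<close> lie on the side of \<open>w\<close>. So no label is missing
  at both ends, and the edge is fully labelled. If the walk goes on, away from \<open>v\<close>, then
  every path from \<open>w\<close> to a label lying ahead extends backwards to a longer path from \<open>v\<close>, so the
  distance to the farthest label ahead drops. Since \<open>A\<close> is finite and paths in \<open>T\<close> are determined by
  their ends, that distance is finite at the start, and the walk cannot continue forever.

  Both the uniqueness of paths and the geometry of the branches at a vertex rest on one consequence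
  of acyclicity, \<open>acyclic_paths_disjoint\<close>: paths that leave a vertex by different edges never meet
  again.
\<close>

section \<open>Paths in acyclic graphs\<close>

lemma is_path_tail: "is_path V E (v # p) \<Longrightarrow> p \<noteq> [] \<Longrightarrow> is_path V E p"
  by (auto simp: is_path_def successively_Cons)

lemma is_path_rev: "is_path V E (rev p) \<longleftrightarrow> is_path V E p"
  by (simp add: is_path_def insert_commute)

lemma is_path_prefix: "is_path V E (p @ q) \<Longrightarrow> p \<noteq> [] \<Longrightarrow> is_path V E p"
  by (auto simp: is_path_def successively_append_iff)

lemma is_path_join:
  "is_path V E (p @ [x]) \<Longrightarrow> is_path V E (x # q) \<Longrightarrow> set p \<inter> set (x # q) = {}
    \<Longrightarrow> is_path V E (p @ x # q)"
  by (auto simp: is_path_def successively_append_iff)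

text \<open>
  Follow \<open>p\<close> up to its first vertex on \<open>q\<close> and return along \<open>q\<close>: this closes a cycle through \<open>v\<close>.
  It has at least three vertices because \<open>p\<close> and \<open>q\<close> start differently.
\<close>

lemma acyclic_paths_disjoint:
  assumes acyclic: "acyclic_graph V E"
    and p: "is_path V E (v # p)" "p \<noteq> []"
    and q: "is_path V E (v # q)" "q \<noteq> []"
    and hd: "hd p \<noteq> hd q"
  shows "set p \<inter> set q = {}"
proof (rule ccontr)
  assume "set p \<inter> set q \<noteq> {}"
  then have "\<exists>x\<in>set p. x \<in> set q" by blast
  then obtain p1 x p2 where p_split: "p = p1 @ x # p2" and xq: "x \<in> set q"
    and p1: "\<forall>y\<in>set p1. y \<notin> set q"
    using split_list_first_prop[of p "\<lambda>x. x \<in> set q"] by metis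
  from xq obtain q1 q2 where q_split: "q = q1 @ x # q2"
    by (meson split_list)
  let ?c = "(v # p1) @ x # rev q1"
  have "is_path V E ((v # p1) @ [x])"
    using is_path_prefix[of V E "(v # p1) @ [x]" p2] p by (simp add: p_split)
  moreover have "is_path V E (x # rev q1)"
    using is_path_prefix[of V E "q1 @ [x]" q2] is_path_tail[OF q] is_path_rev[of V E "q1 @ [x]"]
    by (simp add: q_split)
  moreover have "v \<notin> set q"
    using q by (simp add: is_path_def)
  then have "set (v # p1) \<inter> set (x # rev q1) = {}"
    using p1 by (auto simp: q_split)
  ultimately have "is_path V E ?c"
    by (rule is_path_join)
  moreover have "length ?c \<ge> 3"
    using hd by (cases p1; cases q1) (auto simp: p_split q_split)
  moreover have "{last ?c, hd ?c} \<in> E"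
  proof -
    have "last ?c = hd q"
      by (cases q1) (auto simp: q_split)
    then show ?thesis
      using q by (simp add: is_path_def successively_Cons insert_commute)
  qed
  ultimately show False
    using acyclic unfolding acyclic_graph_def is_cycle_def by blast
qed

lemma acyclic_path_unique:
  assumes "acyclic_graph V E"
    and "is_path V E (v # p)" "is_path V E (v # q)"
    and "last (v # p) = last (v # q)"
  shows "p = q"
  using assms(2-)
proof (induction p arbitrary: v q)
  case Nil
  then show ?case
    by (cases q rule: rev_cases) (auto simp: is_path_def)
next
  case (Cons x p)
  then obtain y q' where q: "q = y # q'"
    by (cases q) (auto simp: is_path_def split: if_splits)
  have last: "last (x # p) = last (y # q')"
    using Cons.prems(3) by (simp add: q)
  have "x = y"
  proof (rule ccontr)
    assume "x \<noteq> y"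
    then have "set (x # p) \<inter> set (y # q') = {}"
      using acyclic_paths_disjoint[OF assms(1) Cons.prems(1) _ Cons.prems(2)] q by simp
    then show False
      using last last_in_set[of "x # p"] last_in_set[of "y # q'"] by auto
  qed
  moreover have "is_path V E (x # p)" "is_path V E (y # q')"
    using Cons.prems q by (auto intro: is_path_tail)
  ultimately show ?case
    using Cons.IH last q by simp
qed

text \<open>The tree may be infinite; what bounds the paths is that the finitely many ends determine them.\<close>

lemma finite_paths_into_finite_set:
  assumes "acyclic_graph V E" "finite A"
  shows "finite {p. is_path V E (v # p) \<and> last (v # p) \<in> A}" (is "finite ?P")
proof (rule inj_on_finite)
  show "inj_on (\<lambda>p. last (v # p)) ?P"
    using acyclic_path_unique[OF assms(1)] by (intro inj_onI) blast
  show "(\<lambda>p. last (v # p)) ` ?P \<subseteq> A"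
    by blast
qed (fact assms(2))

section \<open>Branches at a vertex\<close>

text \<open>
  If \<open>{v, w}\<close> is an edge of a tree, this is the component containing \<open>w\<close> of the tree without \<open>v\<close>.
  Otherwise it is empty, so membership also records that \<open>{v, w}\<close> is an edge.
\<close>

definition branch :: "'v set \<Rightarrow> 'v set set \<Rightarrow> 'v \<Rightarrow> 'v \<Rightarrow> 'v set" where
  "branch V E v w = {last (w # p) |p. is_path V E (v # w # p)}"

lemma branch_edge: "a \<in> branch V E v w \<Longrightarrow> {v, w} \<in> E"
  by (auto simp: branch_def is_path_def)

lemma branch_vertices: "a \<in> branch V E v w \<Longrightarrow> v \<in> V \<and> w \<in> V"
  by (auto simp: branch_def is_path_def)

lemma exists_branch:
  assumes "connected_graph V E" "v \<in> V" "a \<in> V" "a \<noteq> v"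
  obtains w where "a \<in> branch V E v w"
proof -
  obtain p where p: "is_path V E p" "hd p = v" "last p = a"
    using assms unfolding connected_graph_def path_between_def by blast
  have "p \<noteq> []"
    using p(1) by (simp add: is_path_def)
  moreover have "p \<noteq> [v]"
    using p(3) assms(4) by auto
  ultimately obtain w p' where p_eq: "p = v # w # p'"
    using p(2) by (metis list.exhaust list.sel(1))
  have "a = last (w # p')" "is_path V E (v # w # p')"
    using p(1,3) by (simp_all add: p_eq)
  then have "a \<in> branch V E v w"
    unfolding branch_def by blast
  then show thesis by (rule that)
qed

lemma path_through_distinct_branches:
  assumes acyclic: "acyclic_graph V E"
    and a: "a \<in> branch V E v w" and b: "b \<in> branch V E v u" and "w \<noteq> u"
  obtains p where "path_between V E a b p" "v \<in> set p"
proof -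
  obtain p q where p: "is_path V E (v # w # p)" "a = last (w # p)"
    and q: "is_path V E (v # u # q)" "b = last (u # q)"
    using a b unfolding branch_def by blast
  have disj: "set (w # p) \<inter> set (u # q) = {}"
    using acyclic_paths_disjoint[OF acyclic p(1) _ q(1)] \<open>w \<noteq> u\<close> by simp
  let ?r = "rev (v # w # p) @ u # q"
  have "is_path V E (rev (v # w # p))"
    using p(1) by (simp only: is_path_rev)
  then have "is_path V E ?r"
    using q(1) disj by (auto simp: is_path_def successively_append_iff)
  moreover have "hd ?r = a"
    using p(2) by (auto simp: hd_append hd_rev last_rev)
  ultimately have "path_between V E a b ?r"
    using q(2) by (simp add: path_between_def)
  then show thesis
    by (rule that) simp
qed

text \<open>
  A common vertex would be the end of two paths from \<open>w\<close>, one that starts with \<open>v\<close> and one that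
  avoids it.
\<close>

lemma opposite_branches_disjoint:
  assumes acyclic: "acyclic_graph V E"
  shows "branch V E v w \<inter> branch V E w v = {}"
proof (rule ccontr)
  assume "branch V E v w \<inter> branch V E w v \<noteq> {}"
  then obtain p q where p: "is_path V E (v # w # p)" and q: "is_path V E (w # v # q)"
    and last: "last (w # p) = last (v # q)"
    unfolding branch_def by auto
  have "is_path V E (w # p)"
    using p by (auto intro: is_path_tail)
  then have "p = v # q"
    using acyclic_path_unique[OF acyclic _ q] last by simp
  then show False
    using p by (simp add: is_path_def)
qed

text \<open>
  If this failed, \<open>v\<close> would lie on a path leaving \<open>w\<close> through \<open>u\<close>, although the edge from \<open>w\<close> to \<open>v\<close>
  already is a path leaving \<open>w\<close> another way.
\<close>

lemma extend_path_backwards: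
  assumes acyclic: "acyclic_graph V E"
    and "{v, w} \<in> E" "v \<in> V" "v \<noteq> w" "u \<noteq> v"
    and p: "is_path V E (w # u # p)"
  shows "is_path V E (v # w # u # p)"
proof -
  have "is_path V E [w, v]"
    using assms by (auto simp: is_path_def insert_commute)
  then have "set [v] \<inter> set (u # p) = {}"
    using acyclic_paths_disjoint[OF acyclic, of w "[v]" "u # p"] p \<open>u \<noteq> v\<close> by simp
  then show ?thesis
    using assms by (auto simp: is_path_def)
qed

section \<open>Walking towards the missing labels\<close>

text \<open>
  Since \<open>a \<in> l a\<close>, a missing label differs from \<open>v\<close> and so lies in some branch; two missing labels
  in different branches would be joined by a path through \<open>v\<close>, which properness forbids.
\<close>

lemma missing_labels_in_branch:
  assumes tree: "is_tree V E" and "A \<subseteq> V" and proper: "proper_labelling V E A l"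
    and "v \<in> V" and missing: "A - l v \<noteq> {}"
  obtains w where "A - l v \<subseteq> branch V E v w"
proof -
  have *: "\<exists>w. a \<in> branch V E v w" if "a \<in> A - l v" for a
  proof -
    have "a \<noteq> v"
      using that proper by (auto simp: proper_labelling_def)
    then show ?thesis
      using exists_branch[of V E v a] tree that \<open>A \<subseteq> V\<close> \<open>v \<in> V\<close> by (auto simp: is_tree_def)
  qed
  from missing obtain a where a: "a \<in> A - l v" by blast
  with * obtain w where w: "a \<in> branch V E v w" by blast
  have "b \<in> branch V E v w" if b: "b \<in> A - l v" for b
  proof -
    obtain u where u: "b \<in> branch V E v u"
      using * b by blast
    have "w = u"
    proof (rule ccontr)
      assume "w \<noteq> u"
      then obtain p where "path_between V E a b p" "v \<in> set p"
        using path_through_distinct_branches[of V E a v w b u] tree w u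
        by (auto simp: is_tree_def)
      then show False
        using proper a b unfolding proper_labelling_def by blast
    qed
    with u show ?thesis by simp
  qed
  then show thesis
    using that by blast
qed

lemma fully_labelledI:
  assumes "labelling V A l" "v \<in> V" "w \<in> V" "(A - l v) \<inter> (A - l w) = {}"
  shows "fully_labelled A l {v, w}"
proof -
  have "l v \<union> l w = A"
    using assms unfolding labelling_def by blast
  then show ?thesis
    unfolding fully_labelled_def by blast
qed

text \<open>
  The walk of the introductory argument, as an induction on a bound \<open>n\<close> for the number of edges
  from \<open>v\<close> to the farthest label ahead.
\<close>

lemma fully_labelled_edge_ahead:
  assumes tree: "is_tree V E" and "A \<subseteq> V" and proper: "proper_labelling V E A l"
    and "A - l v \<noteq> {}" and "A - l v \<subseteq> branch V E v w"
    and "\<And>p. is_path V E (v # w # p) \<Longrightarrow> last (w # p) \<in> A \<Longrightarrow> length (w # p) \<le> n"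
  shows "\<exists>e\<in>E. fully_labelled A l e"
  using assms(4-)
proof (induction n arbitrary: v w)
  case 0
  then obtain p where "is_path V E (v # w # p)" "last (w # p) \<in> A"
    unfolding branch_def by blast
  then show ?case
    using "0.prems"(3) by fastforce
next
  case (Suc n)
  have acyclic: "acyclic_graph V E"
    using tree by (simp add: is_tree_def)
  from Suc.prems obtain a where a: "a \<in> branch V E v w" by blast
  note edge = branch_edge[OF a]
  have vw: "v \<in> V" "w \<in> V" "v \<noteq> w"
    using a branch_vertices[OF a] by (auto simp: branch_def is_path_def)
  have done_if: ?case if "(A - l v) \<inter> (A - l w) = {}"
    using fully_labelledI[OF _ vw(1,2) that] proper edge by (auto simp: proper_labelling_def)
  show ?case
  proof (cases "A - l w = {}")
    case True
    then show ?thesis using done_if by blast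
  next
    case False
    then obtain u where u: "A - l w \<subseteq> branch V E w u"
      using missing_labels_in_branch[OF tree \<open>A \<subseteq> V\<close> proper vw(2)] by blast
    show ?thesis
    proof (cases "u = v")
      case True
      then show ?thesis
        using done_if u Suc.prems(2) opposite_branches_disjoint[OF acyclic, of v w] by blast
    next
      case u_neq_v: False
      have "length (u # p) \<le> n" if "is_path V E (w # u # p)" "last (u # p) \<in> A" for p
        using Suc.prems(3)[of "u # p"] that
          extend_path_backwards[OF acyclic edge vw(1,3) u_neq_v that(1)] by simp
      then show ?thesis
        using Suc.IH[OF False u] by blast
    qed
  qed
qed

theorem theorem1:
  fixes V :: "'v set" and E :: "'v set set" and A :: "'v set" and l :: "'v \<Rightarrow> 'v set"
  assumes "is_tree V E"
    and "\<exists>x\<in>V. \<exists>y\<in>V. x \<noteq> y"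
    and "A \<subseteq> V"
    and "finite A"
    and "proper_labelling V E A l"
  shows "\<exists>e\<in>E. fully_labelled A l e"
proof -
  obtain v y where v: "v \<in> V" and y: "y \<in> V" "y \<noteq> v"
    using assms(2) by metis
  show ?thesis
  proof (cases "A - l v = {}")
    case True
    obtain w where w: "y \<in> branch V E v w"
      using exists_branch[of V E v y] assms(1) v y by (auto simp: is_tree_def)
    have "fully_labelled A l {v, w}"
      using fully_labelledI[of V A l v w] branch_vertices[OF w] True assms(5)
      by (auto simp: proper_labelling_def)
    then show ?thesis
      using branch_edge[OF w] by blast
  next
    case False
    then obtain w where w: "A - l v \<subseteq> branch V E v w"
      using missing_labels_in_branch[OF assms(1,3,5) v] by blast
    let ?P = "{p. is_path V E (v # p) \<and> last (v # p) \<in> A}"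
    have "finite ?P"
      using assms(1,4) by (intro finite_paths_into_finite_set) (simp_all add: is_tree_def)
    then have "length (w # p) \<le> Max (length ` ?P)"
      if "is_path V E (v # w # p)" "last (w # p) \<in> A" for p
      using that by (intro Max_ge image_eqI[of _ length "w # p"]) simp_all
    then show ?thesis
      using fully_labelled_edge_ahead[OF assms(1,3,5) False w] by blast
  qed
qed

end
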